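(* Let $M\ge 2$, let $p_1,\dots,p_M\ge 0$ be not all equal, let $q>0$, and set $p=\frac1M\sum_{i=1}^M p_i$. Let $f^{\rm het}(t)$ be the expected fraction of adopters in the complete network with $M$ nodes, external rates $\{p_i\}_{i=1}^M$ and internal rates $q_{i,j}=\frac{q}{M-1}$ for all $i\neq j$. Let $f^{\rm hom}(t)$ be the expected fraction of adopters in the homogeneous complete network with $M$ nodes, external rates all equal to $p$, and internal rates $q_{i,j}=\frac{q}{M-1}$ for all $i\ne j$. Then $$f^{\rm het}(t)<f^{\rm hom}(t),\qquad 0<t<\infty .$$
   Context: Discrete Bass model: a network has $M$ nodes, external rates $p_j\ge 0$ and internal rates $q_{i,j}\ge 0$ ($i\ne j$; the influence of $i$ on $j$). $X_j(t)\in\{0,1\}$ is the state of node $j$ ($1$ = adopter), $X_j(0)=0$ for all $j$. The process $(X_1,\dots,X_M)$ is a continuous-time Markov chain in which adopters remain adopters forever, and each nonadopter $j$ becomes an adopter at rate $p_j+\sum_{k\ne j}q_{k,j}X_k(t)$ (one node changes at a time). The expected fraction of adopters is $f(t)=\frac1M\,\mathbf{E}\big[\sum_{j=1}^M X_j(t)\big]$. *)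

theory Defs
  imports "HOL-Probability.Probability"
begin

text \<open>
  A (right-continuous) continuous-time Markov chain on a finite state space, started in
  \<open>x0\<close>, given by its infinitesimal description: for distinct states \<open>x\<close>, \<open>y\<close>,
  the probability of being in \<open>y\<close> at time \<open>t + h\<close> given state \<open>x\<close> at time \<open>t\<close>
  is \<open>r x y * h + o(h)\<close> as \<open>h\<close> decreases to 0, uniformly in \<open>t\<close>.
  Since the state space is finite, this also determines the probability of staying in \<open>x\<close>;
  the values \<open>r x x\<close> are never used. Conditional probabilities given a null event are
  0 by convention in the library, so the conditions below range over non-null events only.
  The process is indexed by all reals, but only times \<open>t \<ge> 0\<close> are meaningful.
\<close>

locale finite_ctmc = prob_space P for P :: "'a measure" +
  fixes X :: "real \<Rightarrow> 'a \<Rightarrow> 's :: finite"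
    and x0 :: 's
    and r :: "'s \<Rightarrow> 's \<Rightarrow> real"
  assumes measurable_state: "\<And>t. 0 \<le> t \<Longrightarrow> X t \<in> P \<rightarrow>\<^sub>M count_space UNIV"
    and initial_state: "\<And>\<omega>. \<omega> \<in> space P \<Longrightarrow> X 0 \<omega> = x0"
    and right_continuous:
      "\<And>\<omega> t. \<omega> \<in> space P \<Longrightarrow> 0 \<le> t \<Longrightarrow> \<forall>\<^sub>F s in at_right t. X s \<omega> = X t \<omega>"
    and markov_property:
      "\<And>T s u w y. finite T \<Longrightarrow> T \<subseteq> {0..<s} \<Longrightarrow> 0 \<le> s \<Longrightarrow> s < u \<Longrightarrow>
         \<P>(\<omega> in P. X s \<omega> = w s \<and> (\<forall>v\<in>T. X v \<omega> = w v)) > 0 \<Longrightarrow>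
         \<P>(\<omega> in P. X u \<omega> = y \<bar> X s \<omega> = w s \<and> (\<forall>v\<in>T. X v \<omega> = w v)) =
         \<P>(\<omega> in P. X u \<omega> = y \<bar> X s \<omega> = w s)"
    and transition_rates:
      "\<And>x y. x \<noteq> y \<Longrightarrow>
         uniform_limit {t. 0 \<le> t \<and> \<P>(\<omega> in P. X t \<omega> = x) > 0}
           (\<lambda>h t. \<P>(\<omega> in P. X (t + h) \<omega> = y \<bar> X t \<omega> = x) / h)
           (\<lambda>t. r x y) (at_right 0)"

text \<open>
  The nodes are the elements of the finite type \<open>'n\<close>, and \<open>x j\<close> says that node \<open>j\<close> is an
  adopter in the network state \<open>x\<close>. The sum over \<open>j\<close> has at most one term: the node whose
  adoption turns \<open>x\<close> into \<open>y\<close>. In particular all other transitions have rate 0, so that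
  adopters remain adopters and no two nodes adopt simultaneously. Here \<open>q k j\<close> is the influence
  of \<open>k\<close> on \<open>j\<close>.
\<close>

definition bass_rate ::
  "('n :: finite \<Rightarrow> real) \<Rightarrow> ('n \<Rightarrow> 'n \<Rightarrow> real) \<Rightarrow> ('n \<Rightarrow> bool) \<Rightarrow> ('n \<Rightarrow> bool) \<Rightarrow> real" where
  "bass_rate p q x y =
     (\<Sum>j | \<not> x j \<and> y = x(j := True). p j + (\<Sum>k\<in>UNIV - {j}. q k j * of_bool (x k)))"

definition bass_process ::
  "('n :: finite \<Rightarrow> real) \<Rightarrow> ('n \<Rightarrow> 'n \<Rightarrow> real) \<Rightarrow> 'a measure \<Rightarrow> (real \<Rightarrow> 'a \<Rightarrow> 'n \<Rightarrow> bool) \<Rightarrow> bool"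
  where
  "bass_process p q P X \<longleftrightarrow> finite_ctmc P X (\<lambda>j. False) (bass_rate p q)"

definition expected_fraction ::
  "'a measure \<Rightarrow> (real \<Rightarrow> 'a \<Rightarrow> 'n :: finite \<Rightarrow> bool) \<Rightarrow> real \<Rightarrow> real" where
  "expected_fraction P X t =
     (\<integral>\<omega>. (\<Sum>j\<in>UNIV. of_bool (X t \<omega> j)) \<partial>P) / real CARD('n)"

end

(*
  Let S A be the probability that no node of A has adopted, and let s n be its sum over the sets A of
  size n. The derivative of S A involves only S A and S (insert k A), and all differential
  inequalities below are solved by the integrating factor exp (c t). If p i <= p j, then
  S (insert i B) >= S (insert j B), so S is negatively correlated with the external rate of A, and
  Chebyshev's sum inequality gives
    s' n >= a n (n + 1) s (n + 1) - (a n (M - n) + n pbar) s n,   where a = q / (M - 1),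
  with equality for the homogeneous network. Downward induction on n shows that every s n is at
  least as large in the heterogeneous network as in the homogeneous one. At n = 1 the inequality
  is strict, and the expected fraction is 1 - s 1 / M.
*)

theory Submission
  imports Defs
begin

section \<open>Derivatives from uniform right difference quotients\<close>

text \<open>For steps below some \<open>d\<close> the quotient is within 1 of \<open>g\<close>,
  hence bounded by \<open>B + 1\<close> at every base point, so \<open>f\<close> is locally
  Lipschitz. Uniformity in the base point gives the estimate to the left as well, since the earlier
  of two times can always serve as base.\<close>

lemma continuous_on_if_uniform_right_quotient:
  fixes f g :: "real \<Rightarrow> real"
  assumes lim: "uniform_limit {0..} (\<lambda>h t. (f (t + h) - f t) / h) g (at_right 0)"
    and bound: "\<And>t. 0 \<le> t \<Longrightarrow> \<bar>g t\<bar> \<le> B"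
  shows "continuous_on {0..} f"
proof -
  have "\<forall>\<^sub>F h in at_right 0. \<forall>t\<in>{0..}. dist ((f (t + h) - f t) / h) (g t) < 1"
    using lim by (rule uniform_limitD) simp
  then obtain d where d: "d > 0"
    and close: "\<And>h t. 0 < h \<Longrightarrow> h < d \<Longrightarrow> 0 \<le> t \<Longrightarrow> dist ((f (t + h) - f t) / h) (g t) < 1"
    by (auto simp: eventually_at_right_field)
  have step: "\<bar>f (t + h) - f t\<bar> \<le> (B + 1) * h" if "0 < h" "h < d" "0 \<le> t" for h t
  proof -
    have "\<bar>(f (t + h) - f t) / h\<bar> \<le> B + 1"
      using close[OF that] bound[OF that(3)] by (auto simp: dist_real_def)
    then show ?thesis
      using that by (simp add: field_simps)
  qed
  have lip: "\<bar>f s - f t\<bar> \<le> (B + 1) * \<bar>s - t\<bar>" if "0 \<le> s" "0 \<le> t" "\<bar>s - t\<bar> < d" for s t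
    using that step[of "t - s" s] step[of "s - t" t]
    by (cases s t rule: linorder_cases) (auto simp: abs_if split: if_splits)
  have B: "B \<ge> 0"
    using bound[of 0] by simp
  show ?thesis
    unfolding continuous_on_iff
  proof (intro ballI allI impI)
    fix t e :: real
    assume t: "t \<in> {0..}" and e: "0 < e"
    show "\<exists>\<delta>>0. \<forall>s\<in>{0..}. dist s t < \<delta> \<longrightarrow> dist (f s) (f t) < e"
    proof (intro exI[of _ "min d (e / (B + 1))"] conjI ballI impI)
      show "0 < min d (e / (B + 1))"
        using d e B by simp
      fix s :: real
      assume s: "s \<in> {0..}" and "dist s t < min d (e / (B + 1))"
      then have "\<bar>s - t\<bar> < d" "(B + 1) * \<bar>s - t\<bar> < e"
        using B by (auto simp: dist_real_def field_simps)
      then show "dist (f s) (f t) < e"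
        using lip[of s t] s t by (auto simp: dist_real_def)
    qed
  qed
qed

text \<open>For \<open>s < t\<close> the quotient at \<open>t\<close> is a right quotient at \<open>s\<close>, so uniformity and continuity
  of \<open>g\<close> control it as well.\<close>

lemma has_derivative_if_uniform_right_quotient:
  fixes f g :: "real \<Rightarrow> real"
  assumes lim: "uniform_limit {0..} (\<lambda>h t. (f (t + h) - f t) / h) g (at_right 0)"
    and cont: "continuous_on {0..} g"
    and t: "0 \<le> t"
  shows "(f has_real_derivative g t) (at t within {0..})"
  unfolding has_field_derivative_iff
proof (rule tendstoI)
  fix e :: real
  assume e: "0 < e"
  have "\<forall>\<^sub>F h in at_right 0. \<forall>t\<in>{0..}. dist ((f (t + h) - f t) / h) (g t) < e / 2"
    using lim by (rule uniform_limitD) (use e in simp)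
  then obtain d where d: "d > 0"
    and close: "\<And>h t. 0 < h \<Longrightarrow> h < d \<Longrightarrow> 0 \<le> t \<Longrightarrow> dist ((f (t + h) - f t) / h) (g t) < e / 2"
    by (auto simp: eventually_at_right_field)
  obtain d' where d': "d' > 0"
    and near: "\<And>s. 0 \<le> s \<Longrightarrow> dist s t < d' \<Longrightarrow> dist (g s) (g t) < e / 2"
    using cont t e unfolding continuous_on_iff
    by (metis atLeast_iff half_gt_zero)
  have "dist ((f s - f t) / (s - t)) (g t) < e"
    if s: "0 \<le> s" "s \<noteq> t" "dist s t < min d d'" for s
  proof (cases "t < s")
    case True
    then show ?thesis
      using close[of "s - t" t] t s e by (simp add: dist_real_def)
  next
    case False
    have "(f s - f t) / (s - t) = (f (s + (t - s)) - f s) / (t - s)"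
      using s(2) by (simp add: divide_simps) (simp add: algebra_simps)
    moreover have "dist ((f (s + (t - s)) - f s) / (t - s)) (g s) < e / 2"
      using False s by (intro close) (auto simp: dist_real_def)
    moreover have "dist (g s) (g t) < e / 2"
      using near s by simp
    ultimately show ?thesis
      using dist_triangle_half_l[of _ "g s" e "g t"] by (metis dist_commute)
  qed
  then show "\<forall>\<^sub>F s in at t within {0..}. dist ((f s - f t) / (s - t)) (g t) < e"
    unfolding eventually_at using d d'
    by (intro exI[of _ "min d d'"]) auto
qed

section \<open>Differential inequalities solved by an integrating factor\<close>

lemma exp_times_has_derivative:
  fixes u :: "real \<Rightarrow> real"
  assumes "(u has_real_derivative u') (at x within {0..})" and "0 < x"
  shows "((\<lambda>x. exp (c * x) * u x) has_real_derivative exp (c * x) * (u' + c * u x)) (at x)"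
proof -
  have "(u has_real_derivative u') (at x)"
    using assms at_within_interior[of x "{0..}"] by simp
  then show ?thesis
    by (auto intro!: derivative_eq_intros simp: algebra_simps)
qed

lemma continuous_on_exp_times:
  fixes u :: "real \<Rightarrow> real"
  assumes "\<And>t. 0 \<le> t \<Longrightarrow> (u has_real_derivative u' t) (at t within {0..})"
  shows "continuous_on {0..t} (\<lambda>x. exp (c * x) * u x)"
proof -
  have "continuous_on {0..} u"
    using assms by (auto simp: continuous_on_eq_continuous_within intro: DERIV_continuous)
  then show ?thesis
    by (intro continuous_intros) (auto elim: continuous_on_subset)
qed

text \<open>The hypothesis says that the derivative of \<open>exp (c * t) * u t\<close> is
  nonnegative. It is later applied with \<open>c\<close> the decay coefficient of a linear equation,
  so that only the source terms remain to be estimated.\<close>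

lemma exp_times_ge_initial:
  fixes u u' :: "real \<Rightarrow> real"
  assumes deriv: "\<And>t. 0 \<le> t \<Longrightarrow> (u has_real_derivative u' t) (at t within {0..})"
    and ge: "\<And>t. 0 < t \<Longrightarrow> 0 \<le> u' t + c * u t"
    and "0 \<le> t"
  shows "u 0 \<le> exp (c * t) * u t"
proof -
  have "exp (c * 0) * u 0 \<le> exp (c * t) * u t"
    by (rule DERIV_nonneg_imp_increasing_open[OF \<open>0 \<le> t\<close> _ continuous_on_exp_times[OF deriv]])
       (use ge exp_times_has_derivative[OF deriv] in \<open>force simp: zero_le_mult_iff\<close>)+
  then show ?thesis
    by simp
qed

text \<open>Strictness is demanded only for positive times: in the comparison of the networks at
  level 1 the source is 0 at time 0, where all survival probabilities equal 1.\<close>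

lemma exp_times_gt_initial:
  fixes u u' :: "real \<Rightarrow> real"
  assumes deriv: "\<And>t. 0 \<le> t \<Longrightarrow> (u has_real_derivative u' t) (at t within {0..})"
    and gt: "\<And>t. 0 < t \<Longrightarrow> 0 < u' t + c * u t"
    and "0 < t"
  shows "u 0 < exp (c * t) * u t"
proof -
  have "exp (c * 0) * u 0 < exp (c * t) * u t"
    by (rule DERIV_pos_imp_increasing_open[OF \<open>0 < t\<close> _ continuous_on_exp_times[OF deriv]])
       (use gt exp_times_has_derivative[OF deriv] in \<open>force simp: zero_less_mult_iff\<close>)+
  then show ?thesis
    by simp
qed

section \<open>The forward equation for expectations along a finite Markov chain\<close>

lemma uniform_limit_sum:
  fixes f :: "'i \<Rightarrow> 'a \<Rightarrow> 'b \<Rightarrow> 'c :: real_normed_vector"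
  assumes "\<And>i. i \<in> I \<Longrightarrow> uniform_limit S (f i) (l i) F"
  shows "uniform_limit S (\<lambda>n x. \<Sum>i\<in>I. f i n x) (\<lambda>x. \<Sum>i\<in>I. l i x) F"
  using assms
proof (induction I rule: infinite_finite_induct)
  case (insert i I)
  then show ?case
    by (simp add: uniform_limit_add)
qed (simp_all add: uniform_limit_const)

context finite_ctmc
begin

definition state_prob :: "real \<Rightarrow> 's \<Rightarrow> real" where
  "state_prob t x = \<P>(\<omega> in P. X t \<omega> = x)"

lemma sets_state [measurable]: "0 \<le> t \<Longrightarrow> {\<omega> \<in> space P. X t \<omega> = x} \<in> sets P"
  using measurable_sets[OF measurable_state, of t "{x}"]
  by (simp add: vimage_def Int_def conj_commute)

lemma expectation_state:
  fixes F :: "'s \<Rightarrow> real"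
  assumes "0 \<le> t"
  shows "expectation (\<lambda>\<omega>. F (X t \<omega>)) = (\<Sum>x\<in>UNIV. F x * state_prob t x)"
proof -
  have "expectation (\<lambda>\<omega>. F (X t \<omega>)) =
      expectation (\<lambda>\<omega>. \<Sum>x\<in>UNIV. F x * indicator {\<omega> \<in> space P. X t \<omega> = x} \<omega>)"
  proof (rule Bochner_Integration.integral_cong)
    fix \<omega> assume "\<omega> \<in> space P"
    then have "(\<Sum>x\<in>UNIV. F x * indicator {\<omega> \<in> space P. X t \<omega> = x} \<omega>) =
        (\<Sum>x\<in>UNIV. if x = X t \<omega> then F x else 0)"
      by (intro sum.cong) (auto simp: indicator_def)
    then show "F (X t \<omega>) = (\<Sum>x\<in>UNIV. F x * indicator {\<omega> \<in> space P. X t \<omega> = x} \<omega>)"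
      by simp
  qed simp
  also have "\<dots> = (\<Sum>x\<in>UNIV. F x * state_prob t x)"
    using assms
    by (subst Bochner_Integration.integral_sum)
       (auto simp: state_prob_def less_top[symmetric] intro!: integrable_mult_right)
  finally show ?thesis .
qed

lemma integrable_state:
  fixes F :: "'s \<Rightarrow> real"
  assumes "0 \<le> t"
  shows "integrable P (\<lambda>\<omega>. F (X t \<omega>))"
proof (rule integrable_const_bound)
  show "AE \<omega> in P. norm (F (X t \<omega>)) \<le> (\<Sum>x\<in>UNIV. \<bar>F x\<bar>)"
    by (auto intro!: member_le_sum)
  show "(\<lambda>\<omega>. F (X t \<omega>)) \<in> borel_measurable P"
    by (rule measurable_compose[OF measurable_state[OF assms]]) simp
qed

lemma state_prob_split:
  assumes "0 \<le> s" "0 \<le> t"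
  shows "state_prob s x = (\<Sum>y\<in>UNIV. \<P>(\<omega> in P. X t \<omega> = y \<and> X s \<omega> = x))"
proof -
  have "state_prob s x = measure P (\<Union>y. {\<omega> \<in> space P. X t \<omega> = y \<and> X s \<omega> = x})"
    unfolding state_prob_def by (rule arg_cong[of _ _ "measure P"]) auto
  also have "\<dots> = (\<Sum>y\<in>UNIV. \<P>(\<omega> in P. X t \<omega> = y \<and> X s \<omega> = x))"
    using assms
    by (intro finite_measure_finite_Union) (auto simp: disjoint_family_on_def intro!: sets.sets_Collect_conj)
  finally show ?thesis .
qed

text \<open>The expected value of the generator applied to \<open>F\<close>. The diagonal is left
  out because \<open>r x x\<close> carries no information.\<close>

definition drift :: "('s \<Rightarrow> real) \<Rightarrow> real \<Rightarrow> real" where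
  "drift F t = (\<Sum>x\<in>UNIV. \<Sum>y\<in>UNIV - {x}. state_prob t x * r x y * (F y - F x))"

text \<open>If \<open>x\<close> has positive probability at time \<open>t\<close>, the conditional
  statement is multiplied by \<open>state_prob t x\<close>, which is at most 1 and so keeps the
  error bound. If it has probability 0, the joint probability and the limit both vanish. Hence
  uniformity extends to all \<open>t\<close> in \<open>{0..}\<close>.\<close>

lemma uniform_limit_joint:
  assumes "x \<noteq> y"
  shows "uniform_limit {0..} (\<lambda>h t. \<P>(\<omega> in P. X (t + h) \<omega> = y \<and> X t \<omega> = x) / h)
    (\<lambda>t. state_prob t x * r x y) (at_right 0)"
proof (rule uniform_limitI)
  fix e :: real
  assume "0 < e"
  then have "\<forall>\<^sub>F h in at_right 0. \<forall>t\<in>{t. 0 \<le> t \<and> \<P>(\<omega> in P. X t \<omega> = x) > 0}.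
      dist (\<P>(\<omega> in P. X (t + h) \<omega> = y \<bar> X t \<omega> = x) / h) (r x y) < e"
    using transition_rates[OF assms] by (intro uniform_limitD)
  then show "\<forall>\<^sub>F h in at_right 0. \<forall>t\<in>{0..}.
      dist (\<P>(\<omega> in P. X (t + h) \<omega> = y \<and> X t \<omega> = x) / h) (state_prob t x * r x y) < e"
    using eventually_at_right_less[of "0::real"]
  proof eventually_elim
    case (elim h)
    show ?case
    proof
      fix t :: real
      assume t: "t \<in> {0..}"
      let ?J = "\<P>(\<omega> in P. X (t + h) \<omega> = y \<and> X t \<omega> = x)"
      have le1: "state_prob t x \<le> 1"
        by (simp add: state_prob_def)
      show "dist (?J / h) (state_prob t x * r x y) < e"
      proof (cases "state_prob t x > 0")
        case True
        then have "dist (?J / state_prob t x / h) (r x y) < e"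
          using elim t by (auto simp: state_prob_def cond_prob_def)
        moreover have "dist (?J / h) (state_prob t x * r x y) =
            state_prob t x * dist (?J / state_prob t x / h) (r x y)"
        proof -
          have "?J / h - state_prob t x * r x y =
              state_prob t x * (?J / state_prob t x / h - r x y)"
            using True elim by (simp add: field_simps)
          then show ?thesis
            using True by (simp add: dist_real_def abs_mult)
        qed
        moreover have "state_prob t x * dist (?J / state_prob t x / h) (r x y) \<le>
            dist (?J / state_prob t x / h) (r x y)"
          using True le1 by (intro mult_left_le_one_le) auto
        ultimately show ?thesis
          by linarith
      next
        case False
        then have z: "state_prob t x = 0"
          by (auto simp: state_prob_def measure_nonneg antisym_conv1 not_less measure_le_0_iff)
        moreover have "?J \<le> state_prob t x"
          unfolding state_prob_def using t elim by (intro finite_measure_mono) auto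
        ultimately have "?J = 0"
          by (simp add: measure_le_0_iff)
        then show ?thesis
          using z \<open>0 < e\<close> by simp
      qed
    qed
  qed
qed

text \<open>Both expectations are expanded over the joint law of the states at \<open>t\<close> and
  \<open>t + h\<close>. The diagonal terms cancel, so off-diagonal rates suffice for the
  limit.\<close>

lemma expectation_increment:
  fixes F :: "'s \<Rightarrow> real"
  assumes "0 \<le> t" "0 < h"
  shows "expectation (\<lambda>\<omega>. F (X (t + h) \<omega>)) - expectation (\<lambda>\<omega>. F (X t \<omega>)) =
    (\<Sum>x\<in>UNIV. \<Sum>y\<in>UNIV - {x}. \<P>(\<omega> in P. X (t + h) \<omega> = y \<and> X t \<omega> = x) * (F y - F x))"
proof -
  let ?J = "\<lambda>x y. \<P>(\<omega> in P. X (t + h) \<omega> = y \<and> X t \<omega> = x)"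
  have "state_prob (t + h) y = (\<Sum>x\<in>UNIV. ?J x y)" for y
    using state_prob_split[of "t + h" t y] assms by (simp add: conj_commute)
  then have "expectation (\<lambda>\<omega>. F (X (t + h) \<omega>)) = (\<Sum>x\<in>UNIV. \<Sum>y\<in>UNIV. F y * ?J x y)"
    using assms by (subst sum.swap) (simp add: expectation_state sum_distrib_left)
  moreover have "expectation (\<lambda>\<omega>. F (X t \<omega>)) = (\<Sum>x\<in>UNIV. \<Sum>y\<in>UNIV. F x * ?J x y)"
    using assms state_prob_split[of t "t + h"] by (simp add: expectation_state sum_distrib_left)
  ultimately have "expectation (\<lambda>\<omega>. F (X (t + h) \<omega>)) - expectation (\<lambda>\<omega>. F (X t \<omega>)) =
      (\<Sum>x\<in>UNIV. \<Sum>y\<in>UNIV. ?J x y * (F y - F x))"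
    by (simp add: sum_subtractf[symmetric] algebra_simps)
  also have "\<dots> = (\<Sum>x\<in>UNIV. \<Sum>y\<in>UNIV - {x}. ?J x y * (F y - F x))"
    by (intro sum.cong sum.mono_neutral_right) auto
  finally show ?thesis .
qed

lemma uniform_limit_expectation_quotient:
  fixes F :: "'s \<Rightarrow> real"
  shows "uniform_limit {0..}
    (\<lambda>h t. (expectation (\<lambda>\<omega>. F (X (t + h) \<omega>)) - expectation (\<lambda>\<omega>. F (X t \<omega>))) / h)
    (drift F) (at_right 0)"
proof -
  have "uniform_limit {0..}
      (\<lambda>h t. \<Sum>x\<in>UNIV. \<Sum>y\<in>UNIV - {x}.
         \<P>(\<omega> in P. X (t + h) \<omega> = y \<and> X t \<omega> = x) / h * (F y - F x))
      (\<lambda>t. \<Sum>x\<in>UNIV. \<Sum>y\<in>UNIV - {x}. state_prob t x * r x y * (F y - F x)) (at_right 0)"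
    by (intro uniform_limit_sum bounded_linear.uniform_limit[OF bounded_linear_mult_left]
          uniform_limit_joint) auto
  moreover have "\<forall>\<^sub>F h in at_right 0. \<forall>t\<in>{0..}.
      (\<Sum>x\<in>UNIV. \<Sum>y\<in>UNIV - {x}.
         \<P>(\<omega> in P. X (t + h) \<omega> = y \<and> X t \<omega> = x) / h * (F y - F x)) =
      (expectation (\<lambda>\<omega>. F (X (t + h) \<omega>)) - expectation (\<lambda>\<omega>. F (X t \<omega>))) / h"
    using eventually_at_right_less[of "0::real"]
    by eventually_elim (simp add: expectation_increment sum_divide_distrib)
  ultimately show ?thesis
    unfolding drift_def by (subst (asm) uniform_limit_cong) auto
qed

lemma state_prob_bounds: "0 \<le> state_prob t x" "state_prob t x \<le> 1"
  by (simp_all add: state_prob_def)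

text \<open>Probabilities are at most 1 and the rates are constant in time, so the drift is bounded.
  Applied to indicators this makes the state probabilities, and then the drift itself, continuous,
  as the differentiation lemma requires.\<close>

lemma continuous_on_expectation:
  fixes F :: "'s \<Rightarrow> real"
  shows "continuous_on {0..} (\<lambda>t. expectation (\<lambda>\<omega>. F (X t \<omega>)))"
proof (rule continuous_on_if_uniform_right_quotient[OF uniform_limit_expectation_quotient])
  fix t :: real
  show "\<bar>drift F t\<bar> \<le> (\<Sum>x\<in>UNIV. \<Sum>y\<in>UNIV - {x}. \<bar>r x y * (F y - F x)\<bar>)"
    unfolding drift_def
  proof (intro order_trans[OF sum_abs] sum_mono)
    fix x y
    have "\<bar>state_prob t x * r x y * (F y - F x)\<bar> = state_prob t x * \<bar>r x y * (F y - F x)\<bar>"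
      by (simp add: abs_mult state_prob_bounds)
    also have "\<dots> \<le> \<bar>r x y * (F y - F x)\<bar>"
      by (intro mult_left_le_one_le) (auto simp: state_prob_bounds)
    finally show "\<bar>state_prob t x * r x y * (F y - F x)\<bar> \<le> \<bar>r x y * (F y - F x)\<bar>" .
  qed
qed

lemma continuous_on_state_prob: "continuous_on {0..} (\<lambda>t. state_prob t x)"
proof -
  have "state_prob t x = expectation (\<lambda>\<omega>. of_bool (X t \<omega> = x))" if "0 \<le> t" for t
    using expectation_state[OF that, of "\<lambda>y. of_bool (y = x)"]
    by (simp add: of_bool_def if_distrib[of "\<lambda>c. c * _"] cong: if_cong)
  then show ?thesis
    using continuous_on_expectation[of "\<lambda>y. of_bool (y = x)"]
    by (subst continuous_on_cong[OF refl]) auto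
qed

lemma expectation_has_derivative:
  fixes F :: "'s \<Rightarrow> real"
  assumes "0 \<le> t"
  shows "((\<lambda>t. expectation (\<lambda>\<omega>. F (X t \<omega>))) has_real_derivative
    expectation (\<lambda>\<omega>. \<Sum>y\<in>UNIV - {X t \<omega>}. r (X t \<omega>) y * (F y - F (X t \<omega>))))
    (at t within {0..})"
proof -
  have "expectation (\<lambda>\<omega>. \<Sum>y\<in>UNIV - {X t \<omega>}. r (X t \<omega>) y * (F y - F (X t \<omega>))) = drift F t"
    using expectation_state[OF assms, of "\<lambda>x. \<Sum>y\<in>UNIV - {x}. r x y * (F y - F x)"]
    by (simp add: drift_def sum_distrib_left sum_distrib_right mult_ac)
  moreover have "continuous_on {0..} (drift F)"
    unfolding drift_def by (intro continuous_intros continuous_on_state_prob)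
  ultimately show ?thesis
    using has_derivative_if_uniform_right_quotient[OF uniform_limit_expectation_quotient _ assms, of F]
    by simp
qed

end


section \<open>The generator of the Bass model and its survival probabilities\<close>

text \<open>After exchanging the sums over states and nodes, each nonadopter \<open>j\<close>
  contributes only at the single state \<open>x(j := True)\<close>.\<close>

lemma bass_rate_drift:
  fixes F :: "('n :: finite \<Rightarrow> bool) \<Rightarrow> real"
  shows "(\<Sum>y\<in>UNIV - {x}. bass_rate p q x y * (F y - F x)) =
    (\<Sum>j | \<not> x j. (p j + (\<Sum>k\<in>UNIV - {j}. q k j * of_bool (x k))) * (F (x(j := True)) - F x))"
proof -
  define w where "w j = p j + (\<Sum>k\<in>UNIV - {j}. q k j * of_bool (x k))" for j
  have "(\<Sum>y\<in>UNIV - {x}. bass_rate p q x y * (F y - F x)) =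
      (\<Sum>y\<in>UNIV. bass_rate p q x y * (F y - F x))"
    by (intro sum.mono_neutral_left) auto
  also have "\<dots> = (\<Sum>y\<in>UNIV. \<Sum>j | \<not> x j.
      if y = x(j := True) then w j * (F (x(j := True)) - F x) else 0)"
  proof (intro sum.cong refl)
    fix y :: "'n \<Rightarrow> bool"
    have "bass_rate p q x y = (\<Sum>j | \<not> x j. if y = x(j := True) then w j else 0)"
      unfolding bass_rate_def w_def
      by (subst sum.inter_filter[symmetric]) (auto intro!: sum.cong)
    then show "bass_rate p q x y * (F y - F x) =
        (\<Sum>j | \<not> x j. if y = x(j := True) then w j * (F (x(j := True)) - F x) else 0)"
      by (simp add: sum_distrib_right) (intro sum.cong, auto)
  qed
  also have "\<dots> = (\<Sum>j | \<not> x j. w j * (F (x(j := True)) - F x))"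
    by (subst sum.swap) simp
  finally show ?thesis
    unfolding w_def .
qed

definition unadopted :: "'n set \<Rightarrow> ('n \<Rightarrow> bool) \<Rightarrow> real" where
  "unadopted A x = of_bool (\<forall>j\<in>A. \<not> x j)"

text \<open>Only an adoption inside \<open>A\<close> changes the indicator, from 1 to 0. As long as
  it is 1, all adopters lie outside \<open>A\<close>, and an adopter \<open>k\<close> is detected by
  \<open>unadopted (insert k A) x - unadopted A x = -1\<close>. This writes the internal influence
  through indicators again, which closes the system.\<close>

lemma bass_rate_drift_unadopted:
  fixes A :: "'n :: finite set"
  shows "(\<Sum>y\<in>UNIV - {x}. bass_rate p (\<lambda>i j. a) x y * (unadopted A y - unadopted A x)) =
    a * card A * (\<Sum>k\<in>-A. unadopted (insert k A) x - unadopted A x) -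
    (\<Sum>j\<in>A. p j) * unadopted A x"
proof (cases "\<forall>j\<in>A. \<not> x j")
  case False
  then have "unadopted A x = 0" "unadopted (insert k A) x = 0" "unadopted A (x(k := True)) = 0" for k
    by (auto simp: unadopted_def)
  then show ?thesis
    unfolding bass_rate_drift by simp
next
  case True
  let ?m = "\<Sum>k\<in>-A. of_bool (x k) :: real"
  \<comment> \<open>The nodes of \<open>A\<close> are nonadopters, so every \<open>j\<close> in
    \<open>A\<close> feels the same number of adopters.\<close>
  have m: "(\<Sum>k\<in>UNIV - {j}. of_bool (x k)) = ?m" if "j \<in> A" for j
    using that True by (intro sum.mono_neutral_right) auto
  have "(\<Sum>y\<in>UNIV - {x}. bass_rate p (\<lambda>i j. a) x y * (unadopted A y - unadopted A x)) =
      (\<Sum>j\<in>A. - (p j + a * (\<Sum>k\<in>UNIV - {j}. of_bool (x k))))"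
    unfolding bass_rate_drift using True
    by (intro sum.mono_neutral_cong_right) (auto simp: unadopted_def sum_distrib_left)
  also have "\<dots> = - (\<Sum>j\<in>A. p j) - a * card A * ?m"
    using m by (simp add: sum_negf sum.distrib sum_subtractf)
  also have "(\<Sum>k\<in>-A. unadopted (insert k A) x - unadopted A x) = - ?m"
    unfolding sum_negf[symmetric] using True by (intro sum.cong) (auto simp: unadopted_def)
  ultimately show ?thesis
    using True by (simp add: unadopted_def)
qed

definition survival :: "'a measure \<Rightarrow> (real \<Rightarrow> 'a \<Rightarrow> 'n \<Rightarrow> bool) \<Rightarrow> 'n set \<Rightarrow> real \<Rightarrow> real" where
  "survival P X A t = (\<integral>\<omega>. unadopted A (X t \<omega>) \<partial>P)"

text \<open>The rest of the argument is about this linear system of differential equations.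
  Separating it from the process lets it be instantiated for both networks, which may live on
  different probability spaces.\<close>

locale survival_system =
  fixes p :: "'n :: finite \<Rightarrow> real" and a :: real and S :: "'n set \<Rightarrow> real \<Rightarrow> real"
  assumes rate_nonneg: "0 \<le> a"
    and S_nonneg: "0 \<le> S A t"
    and S_initial: "S A 0 = 1"
    and S_derivative: "0 \<le> t \<Longrightarrow>
      (S A has_real_derivative
        a * card A * (\<Sum>k\<in>-A. S (insert k A) t - S A t) - (\<Sum>j\<in>A. p j) * S A t)
        (at t within {0..})"

lemma survival_system_bass:
  fixes p :: "'n :: finite \<Rightarrow> real"
  assumes "bass_process p (\<lambda>i j. a) P X" and "0 \<le> a"
  shows "survival_system p a (survival P X)"
proof -
  interpret finite_ctmc P X "\<lambda>j. False" "bass_rate p (\<lambda>i j. a)"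
    using assms(1) by (simp add: bass_process_def)
  show ?thesis
  proof
    show "0 \<le> a"
      by fact
    show "0 \<le> survival P X A t" for A t
      by (simp add: survival_def unadopted_def)
    show "survival P X A 0 = 1" for A
    proof -
      have "survival P X A 0 = expectation (\<lambda>\<omega>. 1)"
        unfolding survival_def
        by (rule Bochner_Integration.integral_cong) (simp_all add: initial_state unadopted_def)
      then show ?thesis
        by (simp add: prob_space)
    qed
    fix A :: "'n set" and t :: real
    assume t: "0 \<le> t"
    \<comment> \<open>Integrability lets the expectation pass through the sums in the generator
      formula.\<close>
    note [simp] = integrable_state[OF t]
    show "(survival P X A has_real_derivative
        a * card A * (\<Sum>k\<in>-A. survival P X (insert k A) t - survival P X A t) -
        (\<Sum>j\<in>A. p j) * survival P X A t) (at t within {0..})"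
      using expectation_has_derivative[OF t, of "unadopted A"]
      by (simp add: bass_rate_drift_unadopted survival_def[abs_def])
  qed
qed

lemma expected_fraction_survival:
  fixes p :: "'n :: finite \<Rightarrow> real"
  assumes "bass_process p q P X" and "0 \<le> t"
  shows "expected_fraction P X t =
    (real CARD('n) - (\<Sum>j\<in>UNIV. survival P X {j} t)) / real CARD('n)"
proof -
  interpret finite_ctmc P X "\<lambda>j. False" "bass_rate p q"
    using assms(1) by (simp add: bass_process_def)
  have "(\<lambda>\<omega>. \<Sum>j\<in>UNIV. of_bool (X t \<omega> j) :: real) =
      (\<lambda>\<omega>. \<Sum>j\<in>UNIV. 1 - unadopted {j} (X t \<omega>))"
    by (intro ext sum.cong refl) (simp add: unadopted_def)
  then have "expectation (\<lambda>\<omega>. \<Sum>j\<in>UNIV. of_bool (X t \<omega> j)) =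
      (\<Sum>j\<in>UNIV. 1 - survival P X {j} t)"
    using integrable_state[OF assms(2)] by (simp add: survival_def prob_space)
  then show ?thesis
    by (simp add: expected_fraction_def sum_subtractf)
qed

section \<open>Chebyshev's sum identity, positivity, and exchange of two nodes\<close>

text \<open>If \<open>p\<close> and \<open>c\<close> are oppositely ordered, every summand on the
  left is nonnegative, which is Chebyshev's inequality. The identity also yields the strict version
  as soon as one summand is positive.\<close>

lemma chebyshev_sum_identity:
  fixes p c :: "'n :: finite \<Rightarrow> real"
  shows "(\<Sum>i\<in>UNIV. \<Sum>j\<in>UNIV. (p i - p j) * (c j - c i)) =
    2 * ((\<Sum>i\<in>UNIV. p i) * (\<Sum>i\<in>UNIV. c i) - real CARD('n) * (\<Sum>i\<in>UNIV. p i * c i))"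
proof -
  have "(p i - p j) * (c j - c i) = p i * c j + p j * c i - p i * c i - p j * c j" for i j
    by (simp add: algebra_simps)
  then have "(\<Sum>i\<in>UNIV. \<Sum>j\<in>UNIV. (p i - p j) * (c j - c i)) =
      (\<Sum>i\<in>UNIV. \<Sum>j\<in>UNIV. p i * c j) + (\<Sum>i\<in>UNIV. \<Sum>j\<in>UNIV. p j * c i) -
      (\<Sum>i\<in>UNIV. \<Sum>j\<in>(UNIV :: 'n set). p i * c i) -
      (\<Sum>i\<in>(UNIV :: 'n set). \<Sum>j\<in>UNIV. p j * c j)"
    by (simp only: sum.distrib sum_subtractf)
  also have "(\<Sum>i\<in>UNIV. \<Sum>j\<in>UNIV. p j * c i) = (\<Sum>i\<in>UNIV. \<Sum>j\<in>UNIV. p i * c j)"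
    by (rule sum.swap)
  also have "\<dots> = (\<Sum>i\<in>UNIV. p i) * (\<Sum>i\<in>UNIV. c i)"
    by (simp only: sum_product)
  finally show ?thesis
    by (simp add: sum_distrib_left[symmetric])
qed

context survival_system
begin

lemma S_pos:
  assumes "0 \<le> t"
  shows "0 < S A t"
proof -
  \<comment> \<open>The total decay coefficient of \<open>S A\<close>; what remains of the
    derivative is a nonnegative combination of the \<open>S (insert k A)\<close>.\<close>
  define c where "c = (\<Sum>j\<in>A. p j) + a * card A * card (-A)"
  have "S A 0 \<le> exp (c * t) * S A t"
  proof (rule exp_times_ge_initial[OF S_derivative _ assms])
    fix s :: real
    have "a * card A * (\<Sum>k\<in>-A. S (insert k A) s - S A s) - (\<Sum>j\<in>A. p j) * S A s + c * S A s =
        a * card A * (\<Sum>k\<in>-A. S (insert k A) s)"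
      by (simp add: c_def sum_subtractf algebra_simps)
    then show "0 \<le> a * card A * (\<Sum>k\<in>-A. S (insert k A) s - S A s) - (\<Sum>j\<in>A. p j) * S A s + c * S A s"
      using rate_nonneg S_nonneg by (simp add: sum_nonneg)
  qed
  then have "0 < exp (c * t) * S A t"
    unfolding S_initial by linarith
  then show ?thesis
    by (simp add: zero_less_mult_iff)
qed

definition swap_diff :: "'n \<Rightarrow> 'n \<Rightarrow> 'n set \<Rightarrow> real \<Rightarrow> real" where
  "swap_diff i j B t = S (insert i B) t - S (insert j B) t"

text \<open>The terms with \<open>S (insert i (insert j B))\<close> cancel, so the system for the differences is
  closed up to the source term \<open>(p j - p i) * S (insert j B) t\<close>.\<close>

lemma swap_diff_derivative:
  fixes i j :: 'n and B defines "R \<equiv> - insert i (insert j B)"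
  assumes "0 \<le> t" "i \<noteq> j" "i \<notin> B" "j \<notin> B"
  shows "(swap_diff i j B has_real_derivative
    (p j - p i) * S (insert j B) t + a * Suc (card B) * (\<Sum>k\<in>R. swap_diff i j (insert k B) t) -
    (p i + (\<Sum>l\<in>B. p l) + a * Suc (card B) * Suc (card R)) * swap_diff i j B t) (at t within {0..})"
proof -
  \<comment> \<open>The complement of \<open>insert i B\<close> has one element more than
    \<open>R\<close>, hence the factor \<open>Suc (card R)\<close> in the decay coefficient.\<close>
  have compl: "- insert i B = insert j R" "- insert j B = insert i R"
    using assms by auto
  have R: "i \<notin> R" "j \<notin> R"
    by (auto simp: R_def)
  have "(swap_diff i j B has_real_derivative
      (a * card (insert i B) * (\<Sum>k\<in>-insert i B. S (insert k (insert i B)) t - S (insert i B) t) -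
        (\<Sum>l\<in>insert i B. p l) * S (insert i B) t) -
      (a * card (insert j B) * (\<Sum>k\<in>-insert j B. S (insert k (insert j B)) t - S (insert j B) t) -
        (\<Sum>l\<in>insert j B. p l) * S (insert j B) t)) (at t within {0..})"
    unfolding swap_diff_def[abs_def] by (intro derivative_intros S_derivative assms)
  from this[unfolded compl] show ?thesis
    by (rule DERIV_cong)
       (use assms(3-) R in \<open>simp add: swap_diff_def sum_subtractf insert_commute algebra_simps\<close>)
qed

text \<open>Induction on the size of the complement of \<open>B\<close>: the source consists of
  differences for the larger sets \<open>insert k B\<close> and of
  \<open>(p j - p i) * S (insert j B)\<close>, all nonnegative. For empty \<open>R\<close> the sum
  is empty, so there is no separate base case.\<close>

lemma swap_diff_nonneg:
  assumes "p i \<le> p j" "i \<noteq> j" "i \<notin> B" "j \<notin> B" "0 \<le> t"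
  shows "0 \<le> swap_diff i j B t"
  using assms(3-5)
proof (induction "card (- B)" arbitrary: B t rule: less_induct)
  case less
  let ?R = "- insert i (insert j B)"
  let ?c = "p i + (\<Sum>l\<in>B. p l) + a * Suc (card B) * Suc (card ?R)"
  have "swap_diff i j B 0 \<le> exp (?c * t) * swap_diff i j B t"
  proof (rule exp_times_ge_initial[OF swap_diff_derivative])
    fix s :: real
    assume "0 < s"
    then have "0 \<le> swap_diff i j (insert k B) s" if "k \<in> ?R" for k
      using that less.prems by (intro less.hyps psubset_card_mono) auto
    then have "0 \<le> (p j - p i) * S (insert j B) s +
        a * Suc (card B) * (\<Sum>k\<in>?R. swap_diff i j (insert k B) s)"
      using assms(1) rate_nonneg S_nonneg
      by (intro add_nonneg_nonneg mult_nonneg_nonneg sum_nonneg) auto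
    then show "0 \<le> (p j - p i) * S (insert j B) s +
        a * Suc (card B) * (\<Sum>k\<in>?R. swap_diff i j (insert k B) s) -
        ?c * swap_diff i j B s + ?c * swap_diff i j B s"
      by linarith
  qed (use assms(2) less.prems in auto)
  then show ?case
    by (simp add: swap_diff_def S_initial zero_le_mult_iff)
qed

text \<open>The differences for larger sets are nonnegative by the weak version, and the remaining
  source is positive because survival probabilities are positive.\<close>

lemma swap_diff_pos:
  assumes "p i < p j" "i \<noteq> j" "i \<notin> B" "j \<notin> B" "0 < t"
  shows "0 < swap_diff i j B t"
proof -
  let ?R = "- insert i (insert j B)"
  let ?c = "p i + (\<Sum>l\<in>B. p l) + a * Suc (card B) * Suc (card ?R)"
  have "swap_diff i j B 0 < exp (?c * t) * swap_diff i j B t"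
  proof (rule exp_times_gt_initial[OF swap_diff_derivative])
    fix s :: real
    assume s: "0 < s"
    then have "0 \<le> swap_diff i j (insert k B) s" if "k \<in> ?R" for k
      using that assms by (intro swap_diff_nonneg) auto
    then have "0 \<le> a * Suc (card B) * (\<Sum>k\<in>?R. swap_diff i j (insert k B) s)"
      using rate_nonneg by (intro mult_nonneg_nonneg sum_nonneg) auto
    moreover have "0 < (p j - p i) * S (insert j B) s"
      using assms(1) s S_pos by simp
    ultimately show "0 < (p j - p i) * S (insert j B) s +
        a * Suc (card B) * (\<Sum>k\<in>?R. swap_diff i j (insert k B) s) -
        ?c * swap_diff i j B s + ?c * swap_diff i j B s"
      by linarith
  qed (use assms in auto)
  then show ?thesis
    by (simp add: swap_diff_def S_initial zero_less_mult_iff)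
qed

section \<open>Sums of survival probabilities over sets of a fixed size\<close>

text \<open>For \<open>S = survival P X\<close> this is the expected number of
  \<open>n\<close>-element sets without adopters, a binomial moment of the number of
  nonadopters.\<close>

definition level :: "nat \<Rightarrow> real \<Rightarrow> real" where
  "level n t = (\<Sum>A | card A = n. S A t)"

definition weighted_level :: "nat \<Rightarrow> real \<Rightarrow> real" where
  "weighted_level n t = (\<Sum>A | card A = n. (\<Sum>j\<in>A. p j) * S A t)"

text \<open>The coefficient of \<open>p i\<close> in \<open>weighted_level n\<close>; Chebyshev's
  inequality is applied to it and \<open>p\<close>.\<close>

definition node_level :: "nat \<Rightarrow> 'n \<Rightarrow> real \<Rightarrow> real" where
  "node_level n i t = (\<Sum>A | card A = n \<and> i \<in> A. S A t)"

text \<open>Double counting: a set \<open>C\<close> of size \<open>Suc n\<close> arises as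
  \<open>insert k A\<close> once for each of its \<open>Suc n\<close> elements
  \<open>k\<close>.\<close>

lemma sum_S_insert: "(\<Sum>A | card A = n. \<Sum>k\<in>-A. S (insert k A) t) = Suc n * level (Suc n) t"
proof -
  have "(\<Sum>A | card A = n. \<Sum>k\<in>-A. S (insert k A) t) =
      (\<Sum>(A, k)\<in>Sigma {A. card A = n} uminus. S (insert k A) t)"
    by (simp add: sum.Sigma)
  also have "\<dots> = (\<Sum>(C, k)\<in>Sigma {C. card C = Suc n} (\<lambda>C. C). S C t)"
    by (rule sum.reindex_bij_witness[where j = "\<lambda>(A, k). (insert k A, k)"
          and i = "\<lambda>(C, k). (C - {k}, k)"])
       (auto simp: card_Diff_singleton insert_absorb)
  also have "\<dots> = Suc n * level (Suc n) t"
    by (simp add: sum.Sigma[symmetric] level_def sum_distrib_left)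
  finally show ?thesis .
qed

text \<open>Double counting turns the gain into the next level; only the external loss
  \<open>weighted_level n\<close> is not a function of the levels. Truncation in
  \<open>CARD('n) - n\<close> is harmless, since beyond \<open>CARD('n)\<close> all sums are
  empty.\<close>

lemma level_derivative:
  assumes "0 \<le> t"
  shows "(level n has_real_derivative
    a * n * Suc n * level (Suc n) t - a * n * real (CARD('n) - n) * level n t - weighted_level n t)
    (at t within {0..})"
proof -
  have "(level n has_real_derivative
      (\<Sum>A | card A = n. a * card A * (\<Sum>k\<in>-A. S (insert k A) t - S A t) - (\<Sum>j\<in>A. p j) * S A t))
      (at t within {0..})"
    unfolding level_def[abs_def] by (intro DERIV_sum S_derivative assms)
  moreover have "(\<Sum>A | card A = n. a * card A * (\<Sum>k\<in>-A. S (insert k A) t - S A t) -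
        (\<Sum>j\<in>A. p j) * S A t) =
      (\<Sum>A | card A = n. a * n * (\<Sum>k\<in>-A. S (insert k A) t) - a * n * real (CARD('n) - n) * S A t -
        (\<Sum>j\<in>A. p j) * S A t)"
    by (intro sum.cong) (auto simp: sum_subtractf Compl_eq_Diff_UNIV card_Diff_subset algebra_simps)
  moreover have "\<dots> =
      a * n * Suc n * level (Suc n) t - a * n * real (CARD('n) - n) * level n t - weighted_level n t"
    using sum_S_insert[where n = n and t = t]
    by (simp add: sum_subtractf sum_distrib_left[symmetric] level_def weighted_level_def
             del: of_nat_Suc)
  ultimately show ?thesis
    by simp
qed

lemma weighted_level_node: "weighted_level n t = (\<Sum>i\<in>UNIV. p i * node_level n i t)"
proof -
  have "weighted_level n t = (\<Sum>A | card A = n. \<Sum>i\<in>UNIV. if i \<in> A then p i * S A t else 0)"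
    by (simp add: weighted_level_def sum_distrib_right sum.If_cases)
  also have "\<dots> = (\<Sum>i\<in>UNIV. \<Sum>A | card A = n. if i \<in> A then p i * S A t else 0)"
    by (rule sum.swap)
  also have "\<dots> = (\<Sum>i\<in>UNIV. p i * node_level n i t)"
    by (simp add: node_level_def sum_distrib_left sum.inter_filter[symmetric])
  finally show ?thesis .
qed

lemma sum_node_level: "(\<Sum>i\<in>UNIV. node_level n i t) = n * level n t"
proof -
  have "(\<Sum>i\<in>UNIV. node_level n i t) = (\<Sum>i\<in>UNIV. \<Sum>A | card A = n. if i \<in> A then S A t else 0)"
    by (simp add: node_level_def sum.inter_filter[symmetric])
  also have "\<dots> = (\<Sum>A | card A = n. \<Sum>i\<in>UNIV. if i \<in> A then S A t else 0)"
    by (rule sum.swap)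
  also have "\<dots> = n * level n t"
    by (simp add: level_def sum_distrib_left sum.If_cases)
  finally show ?thesis .
qed

text \<open>Sets containing both \<open>i\<close> and \<open>j\<close> count equally on both sides.
  The others are paired by exchanging \<open>j\<close> for \<open>i\<close>, which does not decrease
  survival when \<open>p i\<close> is at most \<open>p j\<close>.\<close>

lemma node_level_antimono:
  assumes "p i \<le> p j" "0 \<le> t"
  shows "node_level n j t \<le> node_level n i t"
proof (cases "i = j")
  case False
  have split: "node_level n k t = (\<Sum>A | card A = n \<and> i \<in> A \<and> j \<in> A. S A t) +
      (\<Sum>A | card A = n \<and> k \<in> A \<and> l \<notin> A. S A t)" if "{k, l} = {i, j}" for k l
    unfolding node_level_def
    by (subst sum.union_disjoint[symmetric])
       (use that in \<open>auto simp: doubleton_eq_iff intro!: sum.cong\<close>)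
  \<comment> \<open>The exchange preserves cardinality: a set with an element has positive size, so
    the truncated subtraction is undone.\<close>
  have Suc_card: "Suc (card A - Suc 0) = card A" if "k \<in> A" for k and A :: "'n set"
    using that card_gt_0_iff[of A] by auto
  have "(\<Sum>A | card A = n \<and> j \<in> A \<and> i \<notin> A. S A t) =
      (\<Sum>A | card A = n \<and> i \<in> A \<and> j \<notin> A. S (insert j (A - {i})) t)"
    by (rule sum.reindex_bij_witness[where i = "\<lambda>A. insert j (A - {i})"
          and j = "\<lambda>A. insert i (A - {j})"])
       (use False in \<open>auto simp: card_insert_if card_Diff_singleton insert_absorb intro: Suc_card\<close>)
  also have "\<dots> \<le> (\<Sum>A | card A = n \<and> i \<in> A \<and> j \<notin> A. S A t)"
  proof (rule sum_mono)
    fix A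
    assume "A \<in> {A. card A = n \<and> i \<in> A \<and> j \<notin> A}"
    then show "S (insert j (A - {i})) t \<le> S A t"
      using swap_diff_nonneg[OF assms(1) False, of "A - {i}" t] assms(2)
      by (auto simp: swap_diff_def insert_absorb)
  qed
  finally show ?thesis
    using split[OF refl] split[OF insert_commute] by linarith
qed simp

text \<open>Chebyshev's inequality for \<open>p\<close> and the oppositely ordered
  \<open>node_level n\<close>, whose total is \<open>n * level n t\<close>.\<close>

lemma weighted_level_le:
  assumes "0 \<le> t"
  shows "weighted_level n t \<le> (\<Sum>i\<in>UNIV. p i) / real CARD('n) * n * level n t"
proof -
  have "0 \<le> (\<Sum>i\<in>UNIV. \<Sum>j\<in>UNIV. (p i - p j) * (node_level n j t - node_level n i t))"
  proof (intro sum_nonneg)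
    fix i j
    show "0 \<le> (p i - p j) * (node_level n j t - node_level n i t)"
      using node_level_antimono[of i j t n] node_level_antimono[of j i t n] assms
      by (cases "p i \<le> p j") (auto simp: zero_le_mult_iff)
  qed
  then have "CARD('n) * weighted_level n t \<le> (\<Sum>i\<in>UNIV. p i) * (n * level n t)"
    by (simp add: chebyshev_sum_identity weighted_level_node sum_node_level)
  then show ?thesis
    by (simp add: field_simps)
qed

lemma node_level_1: "node_level (Suc 0) i t = S {i} t"
proof -
  have "{A. card A = Suc 0 \<and> i \<in> A} = {{i}}"
    by (auto simp: card_Suc_eq)
  then show ?thesis
    by (simp add: node_level_def)
qed

lemma level_1: "level (Suc 0) t = (\<Sum>i\<in>UNIV. S {i} t)"
  using sum_node_level[of 1 t] by (simp add: node_level_1)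

lemma weighted_level_1_less:
  assumes "0 < t" "p i \<noteq> p j"
  shows "weighted_level 1 t < (\<Sum>i\<in>UNIV. p i) / real CARD('n) * level 1 t"
proof -
  have strict: "0 < (p i - p j) * (S {j} t - S {i} t)" if "p i \<noteq> p j" for i j
    using swap_diff_pos[of i j "{}" t] swap_diff_pos[of j i "{}" t] that assms(1)
    by (cases "i = j"; cases "p i < p j") (auto simp: swap_diff_def zero_less_mult_iff)
  then have nonneg: "0 \<le> (p i - p j) * (S {j} t - S {i} t)" for i j
    by (cases "p i = p j") (auto intro: less_imp_le)
  have "0 < (\<Sum>i\<in>UNIV. \<Sum>j\<in>UNIV. (p i - p j) * (S {j} t - S {i} t))"
    using assms(2) strict nonneg
    \<comment> \<open>The one summand at the given pair with \<open>p i\<close> different from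
      \<open>p j\<close> makes the double sum positive.\<close>
    by (intro sum_pos2[of _ i] sum_pos2[of _ j] sum_nonneg) auto
  then have "CARD('n) * weighted_level 1 t < (\<Sum>i\<in>UNIV. p i) * level 1 t"
    using weighted_level_node[of 1 t] sum_node_level[of 1 t]
    by (simp add: chebyshev_sum_identity node_level_1)
  then show ?thesis
    by (simp add: field_simps)
qed

end

section \<open>Comparison of the heterogeneous and the homogeneous network\<close>

locale survival_pair = het: survival_system p a S + hom: survival_system "\<lambda>i. pbar" a T
  for p :: "'n :: finite \<Rightarrow> real" and a :: real and S and pbar :: real
    and T :: "'n set \<Rightarrow> real \<Rightarrow> real" +
  assumes mean: "pbar = (\<Sum>i\<in>UNIV. p i) / real CARD('n)"
begin

lemma hom_weighted_level: "hom.weighted_level n t = pbar * n * hom.level n t"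
  by (simp add: hom.weighted_level_def hom.level_def sum_distrib_left mult_ac)

lemma level_initial: "het.level n 0 = hom.level n 0"
  by (simp add: het.level_def hom.level_def het.S_initial hom.S_initial)

text \<open>The homogeneous external loss is exactly \<open>pbar * n * hom.level n t\<close>, so the
  only new source besides the next level is the Chebyshev gap of the heterogeneous network.\<close>

lemma level_diff_derivative:
  assumes "0 \<le> t"
  shows "((\<lambda>t. het.level n t - hom.level n t) has_real_derivative
    a * n * Suc n * (het.level (Suc n) t - hom.level (Suc n) t) +
    (pbar * n * het.level n t - het.weighted_level n t) -
    (a * n * real (CARD('n) - n) + pbar * n) * (het.level n t - hom.level n t)) (at t within {0..})"
  by (rule DERIV_cong[OF DERIV_diff[OF het.level_derivative hom.level_derivative]])
     (use assms in \<open>simp_all add: hom_weighted_level algebra_simps\<close>)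

lemma level_mono:
  assumes "0 \<le> t"
  shows "hom.level n t \<le> het.level n t"
  using assms
\<comment> \<open>The \<open>Suc\<close> makes the measure drop also from
  \<open>n = CARD('n)\<close> to the next level, where there are no sets and both levels are
  0.\<close>
proof (induction "Suc CARD('n) - n" arbitrary: n t rule: less_induct)
  case less
  show ?case
  proof (cases "n \<le> CARD('n)")
    case False
    then have "{A :: 'n set. card A = n} = {}"
      using card_mono[of "UNIV :: 'n set"] by auto
    then show ?thesis
      by (simp add: het.level_def hom.level_def)
  next
    case True
    let ?c = "a * n * real (CARD('n) - n) + pbar * n"
    have "het.level n 0 - hom.level n 0 \<le> exp (?c * t) * (het.level n t - hom.level n t)"
    proof (rule exp_times_ge_initial[OF level_diff_derivative _ less.prems])
      fix s :: real
      assume s: "0 < s"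
      then have "0 \<le> a * n * Suc n * (het.level (Suc n) s - hom.level (Suc n) s)"
        using less.hyps[of "Suc n" s] True het.rate_nonneg by (simp del: of_nat_Suc)
      moreover have "0 \<le> pbar * n * het.level n s - het.weighted_level n s"
        using het.weighted_level_le[of s n] s by (simp add: mean)
      ultimately show "0 \<le> a * n * Suc n * (het.level (Suc n) s - hom.level (Suc n) s) +
          (pbar * n * het.level n s - het.weighted_level n s) -
          ?c * (het.level n s - hom.level n s) + ?c * (het.level n s - hom.level n s)"
        by linarith
    qed
    then show ?thesis
      by (simp add: level_initial zero_le_mult_iff)
  qed
qed

text \<open>The difference at level 2 is nonnegative, and the Chebyshev gap at level 1 is positive
  at every positive time.\<close>

lemma level_1_less:
  assumes "0 < t" "p i \<noteq> p j"
  shows "hom.level 1 t < het.level 1 t"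
proof -
  let ?c = "a * real 1 * real (CARD('n) - 1) + pbar * real 1"
  have "het.level 1 0 - hom.level 1 0 < exp (?c * t) * (het.level 1 t - hom.level 1 t)"
  proof (rule exp_times_gt_initial[OF level_diff_derivative _ assms(1)])
    fix s :: real
    assume s: "0 < s"
    then have "0 \<le> a * real 1 * Suc 1 * (het.level (Suc 1) s - hom.level (Suc 1) s)"
      using level_mono[of s "Suc 1"] het.rate_nonneg by (simp del: of_nat_Suc)
    moreover have "0 < pbar * real 1 * het.level 1 s - het.weighted_level 1 s"
      using het.weighted_level_1_less[OF s assms(2)] by (simp add: mean)
    ultimately show "0 < a * real 1 * Suc 1 * (het.level (Suc 1) s - hom.level (Suc 1) s) +
        (pbar * real 1 * het.level 1 s - het.weighted_level 1 s) -
        ?c * (het.level 1 s - hom.level 1 s) + ?c * (het.level 1 s - hom.level 1 s)"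
      by linarith
  qed
  then show ?thesis
    by (simp add: level_initial zero_less_mult_iff)
qed

end

theorem theorem3:
  fixes p :: "'n :: finite \<Rightarrow> real"
    and q pbar t :: real
    and P_het :: "'a measure" and X_het :: "real \<Rightarrow> 'a \<Rightarrow> 'n \<Rightarrow> bool"
    and P_hom :: "'b measure" and X_hom :: "real \<Rightarrow> 'b \<Rightarrow> 'n \<Rightarrow> bool"
  assumes "CARD('n) \<ge> 2"
    and "\<And>i. p i \<ge> 0"
    and "\<exists>i j. p i \<noteq> p j"
    and "q > 0"
    and "pbar = (\<Sum>i\<in>UNIV. p i) / real CARD('n)"
    and "bass_process p (\<lambda>i j. q / (real CARD('n) - 1)) P_het X_het"
    and "bass_process (\<lambda>i. pbar) (\<lambda>i j. q / (real CARD('n) - 1)) P_hom X_hom"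
    and "0 < t"
  shows "expected_fraction P_het X_het t < expected_fraction P_hom X_hom t"
proof -
  let ?a = "q / (real CARD('n) - 1)"
  \<comment> \<open>With at least two nodes the denominator is positive.\<close>
  have "0 \<le> ?a"
    using assms(1,4) by simp
  then interpret survival_pair p ?a "survival P_het X_het" pbar "survival P_hom X_hom"
    using assms(5-7) by (intro survival_pair.intro survival_pair_axioms.intro survival_system_bass)
  obtain i j where "p i \<noteq> p j"
    using assms(3) by blast
  then have "hom.level 1 t < het.level 1 t"
    by (rule level_1_less[OF assms(8)])
  \<comment> \<open>The expected fraction is \<open>1 - level 1 t / CARD('n)\<close> in each
    network, so the inequality reverses.\<close>
  then show ?thesis
    using assms(6-8)
    by (simp add: expected_fraction_survival het.level_1 hom.level_1 divide_strict_right_mono)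
qed

end
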